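(* Let $Y=\{1,2,3,\ldots,n\}$, let $P(Y)$ be the power set of $Y$, let $\mathbb{M}=P(Y)\setminus\{\emptyset\}$, and let $\Gamma(\mathbb{M})$ be the intersection graph of $\mathbb{M}$, with metric dimension $\dim_{\Gamma(\mathbb{M})}$. Then: a) $\dim_{\Gamma(\mathbb{M})}=n$; and b) the exchange property holds in $\Gamma(\mathbb{M})$ if and only if $n=2$.
   Context: The intersection graph $\Gamma(\mathbb{M})$ of a collection of sets $\mathbb{M}$ is the simple graph whose vertices are the sets in $\mathbb{M}$, two distinct vertices $A,B$ being joined by an edge if $A\cap B\neq\emptyset$. In a finite simple connected graph $\Gamma$, $d(u,v)$ is the length of a shortest path between $u$ and $v$. A set $W=\{w_1,\ldots,w_k\}$ of vertices is a resolving set if distinct vertices $v$ of $\Gamma$ have distinct representations $r(v|W)=(d(v,w_1),\ldots,d(v,w_k))$. The metric dimension $\dim_\Gamma$ is the minimum cardinality of a resolving set. A resolving set $W$ of cardinality $k$ is minimal if it does not contain a resolving set of cardinality $k-1$ as a proper subset. The exchange property (for resolving sets) holds in $\Gamma$ if whenever $W_1$ and $W_2$ are minimal resolving sets for $\Gamma$ and $r\in W_1$, there exists $s\in W_2$ such that $(W_2\setminus\{s\})\cup\{r\}$ is also a minimal resolving set.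
   Formalization: Part a) is stated only for n ≠ 2 (for n = 2 the graph is a path on three vertices, of metric dimension 1), and part b) only for n ≥ 2 (for n = 1 the graph has one vertex and the exchange property holds trivially). *)

theory Defs
  imports "Graph_Theory.Graph_Theory"
begin

text \<open>
  A finite simple graph is an instance of the locale \<^locale>\<open>graph\<close>, i.e. a finite symmetric
  digraph without loops and multiple arcs; each undirected edge is a pair of opposite arcs.
\<close>

definition intersection_graph :: "'a set set \<Rightarrow> 'a set pair_pre_digraph" where
  "intersection_graph M =
    \<lparr> pverts = M, parcs = {(A, B). A \<in> M \<and> B \<in> M \<and> A \<noteq> B \<and> A \<inter> B \<noteq> {}} \<rparr>"

lemma pair_graph_intersection_graph:
  assumes "finite M"
  shows "pair_graph (intersection_graph M)"
proof
  show "finite (pverts (intersection_graph M))"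
    using assms by (simp add: intersection_graph_def)
  have "parcs (intersection_graph M) \<subseteq> M \<times> M"
    by (auto simp: intersection_graph_def)
  then show "finite (parcs (intersection_graph M))"
    using assms by (meson finite_SigmaI finite_subset)
  show "symmetric (with_proj (intersection_graph M))"
    by (auto simp: symmetric_def arcs_ends_def arc_to_ends_def intersection_graph_def sym_def
        image_iff)
qed (auto simp: intersection_graph_def)

lemma graph_intersection_graph:
  assumes "finite M"
  shows "graph (with_proj (intersection_graph M))"
proof -
  interpret pair_graph "intersection_graph M"
    using assms by (rule pair_graph_intersection_graph)
  show ?thesis by unfold_locales
qed

context graph
begin

text \<open>
  The weighted distance of the library with unit weights. It is an extended real (infinite
  between different components).
\<close>
definition graph_dist :: "'a \<Rightarrow> 'a \<Rightarrow> ereal" where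
  "graph_dist u v = \<mu> (\<lambda>_. 1) u v"

text \<open>
  The vector of distances is indexed by the elements of \<^term>\<open>W\<close> themselves instead of by an
  enumeration of \<^term>\<open>W\<close>; whether two such vectors agree does not depend on the enumeration.
\<close>
definition representation :: "'a set \<Rightarrow> 'a \<Rightarrow> 'a \<Rightarrow> ereal" where
  "representation W v = (\<lambda>w\<in>W. graph_dist v w)"

text \<open>
  Resolving sets \<open>{w1, ..., wk}\<close> are required to be nonempty. This matters for the one-vertex
  graph only, whose metric dimension is thus 1.
\<close>
definition resolving_set :: "'a set \<Rightarrow> bool" where
  "resolving_set W \<longleftrightarrow> W \<subseteq> verts G \<and> W \<noteq> {} \<and> inj_on (representation W) (verts G)"

definition metric_dimension :: nat where
  "metric_dimension = (LEAST k. \<exists>W. resolving_set W \<and> card W = k)"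

definition minimal_resolving_set :: "'a set \<Rightarrow> bool" where
  "minimal_resolving_set W \<longleftrightarrow>
    resolving_set W \<and> \<not> (\<exists>W'. W' \<subset> W \<and> resolving_set W' \<and> card W' = card W - 1)"

definition exchange_property :: bool where
  "exchange_property \<longleftrightarrow>
    (\<forall>W1 W2 r. minimal_resolving_set W1 \<and> minimal_resolving_set W2 \<and> r \<in> W1 \<longrightarrow>
      (\<exists>s\<in>W2. minimal_resolving_set ((W2 - {s}) \<union> {r})))"

end

end

theory Submission
  imports Defs
begin

text \<open>
  A set \<open>W\<close> of vertices resolves \<open>\<Gamma>(\<M>)\<close> iff the vertices outside \<open>W\<close> are told apart by which
  members of \<open>W\<close> they meet. Hence the \<open>n\<close> singletons resolve, and \<open>2^n - 1 \<le> |W| + 2^|W|\<close> for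
  every resolving \<open>W\<close>, which forces \<open>|W| \<ge> n\<close> for \<open>n \<ge> 3\<close>.

  For \<open>n \<ge> 3\<close> the exchange property is refuted with \<open>r = Y\<close>. The set of all vertices except \<open>{a}\<close>
  and \<open>Y - {a}\<close> is resolving, but without \<open>Y\<close> it no longer separates \<open>Y\<close> from \<open>Y - {a}\<close>; so \<open>Y\<close>
  lies in some minimal resolving set. On the other hand, \<open>Y\<close> meets every vertex and hence separates
  no pair of vertices different from \<open>Y\<close>, which makes it a useless replacement in the resolving set
  of the singletons (if \<open>n \<ge> 4\<close>) or in \<open>{{a}, {a, b}, {a, c}}\<close> (if \<open>Y = {a, b, c}\<close>).
\<close>

lemma card_ge_3E:
  assumes "card A \<ge> 3"
  obtains a b c where "a \<in> A" "b \<in> A" "c \<in> A" "a \<noteq> b" "a \<noteq> c" "b \<noteq> c"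
proof -
  obtain T where "T \<subseteq> A" "card T = 3"
    using obtain_subset_with_card_n[OF assms] by metis
  moreover from this(2) obtain a b c where "T = {a, b, c}" "a \<noteq> b" "b \<noteq> c" "a \<noteq> c"
    unfolding card_3_iff by metis
  ultimately show ?thesis
    using that[of a b c] by simp
qed

section \<open>Distances and resolving sets in graphs\<close>

context graph
begin

section \<open>Small distances from walks\<close>

lemma awalk_cost_unit: "awalk_cost (\<lambda>_. 1) p = real (length p)"
  by (induction p) auto

lemma graph_dist_le:
  assumes "awalk u p v"
  shows "graph_dist u v \<le> ereal (real (length p))"
  using min_cost_le_walk_cost[OF assms, of "\<lambda>_. 1"]
  by (simp add: graph_dist_def awalk_cost_unit)

lemma graph_dist_ge:
  assumes "\<And>p. awalk u p v \<Longrightarrow> k \<le> length p"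
  shows "ereal (real k) \<le> graph_dist u v"
  unfolding graph_dist_def \<mu>_def
proof (rule INF_greatest)
  fix p
  assume "p \<in> {p. awalk u p v}"
  then have "k \<le> length p"
    using assms by blast
  then show "ereal (real k) \<le> ereal (awalk_cost (\<lambda>_. 1) p)"
    by (simp only: awalk_cost_unit of_nat_le_iff ereal_less_eq)
qed

text \<open>The library's \<open>\<mu>\<close> is an infimum over all walks, so one walk of length
  \<open>k\<close> together with a lower bound on every walk pins the value.\<close>

lemma graph_dist_eqI:
  assumes "awalk u p v" "length p = k" "\<And>q. awalk u q v \<Longrightarrow> k \<le> length q"
  shows "graph_dist u v = ereal (real k)"
  using graph_dist_le[OF assms(1)] graph_dist_ge[OF assms(3)] unfolding assms(2) by (rule antisym)

lemma graph_dist_self: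
  assumes "u \<in> verts G"
  shows "graph_dist u u = 0"
proof -
  have "awalk u [] u"
    using assms by (simp add: awalk_Nil_iff)
  then have "graph_dist u u = ereal (real 0)"
    by (rule graph_dist_eqI) simp_all
  then show ?thesis
    by simp
qed

lemma graph_dist_adjacent:
  assumes "u \<rightarrow> v"
  shows "graph_dist u v = 1"
proof -
  obtain e where e: "e \<in> arcs G" "tail G e = u" "head G e = v"
    using assms by (auto simp: arcs_ends_conv)
  then have "u \<noteq> v"
    using no_loops[OF e(1)] by simp
  then have "1 \<le> length q" if "awalk u q v" for q
    using that by (cases q) (auto simp: awalk_Nil_iff)
  moreover have "awalk u [e] v"
    using e by (auto simp: awalk_simps)
  ultimately have "graph_dist u v = ereal (real 1)"
    by (intro graph_dist_eqI[where p = "[e]"]) simp_all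
  then show ?thesis
    by simp
qed

lemma graph_dist_common_neighbour:
  assumes "u \<noteq> v" "\<not> u \<rightarrow> v" "u \<rightarrow> w" "w \<rightarrow> v"
  shows "graph_dist u v = 2"
proof -
  obtain e f where ef: "e \<in> arcs G" "tail G e = u" "head G e = w"
      "f \<in> arcs G" "tail G f = w" "head G f = v"
    using assms(3,4) by (auto simp: arcs_ends_conv)
  have "2 \<le> length q" if q: "awalk u q v" for q
  proof (cases q)
    case Nil
    then show ?thesis using q assms(1) by (simp add: awalk_Nil_iff)
  next
    case (Cons x xs)
    then show ?thesis
      using q assms(2) by (cases xs) (auto simp: awalk_simps arcs_ends_conv)
  qed
  moreover have "awalk u [e, f] v"
    using ef by (auto simp: awalk_simps)
  ultimately have "graph_dist u v = ereal (real 2)"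
    by (intro graph_dist_eqI[where p = "[e, f]"]) simp_all
  then show ?thesis
    by simp
qed

section \<open>Resolving sets and minimality\<close>

lemma resolving_set_iff_dist:
  "resolving_set W \<longleftrightarrow> W \<subseteq> verts G \<and> W \<noteq> {} \<and>
    (\<forall>u\<in>verts G. \<forall>v\<in>verts G. (\<forall>w\<in>W. graph_dist u w = graph_dist v w) \<longrightarrow> u = v)"
proof -
  have "representation W u = representation W v \<longleftrightarrow> (\<forall>w\<in>W. graph_dist u w = graph_dist v w)" for u v
    by (auto simp: representation_def restrict_def fun_eq_iff)
  then show ?thesis
    by (simp add: resolving_set_def inj_on_def)
qed

lemma resolving_set_mono:
  assumes "resolving_set W" "W \<subseteq> W'" "W' \<subseteq> verts G"
  shows "resolving_set W'"
proof -
  have "W' \<noteq> {}"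
    using assms(1,2) by (auto simp: resolving_set_def)
  moreover have "u = v" if "u \<in> verts G" "v \<in> verts G" "\<forall>w\<in>W'. graph_dist u w = graph_dist v w" for u v
    using assms(1,2) that unfolding resolving_set_iff_dist by blast
  ultimately show ?thesis
    using assms(3) unfolding resolving_set_iff_dist by blast
qed

lemma finite_resolving_set: "resolving_set W \<Longrightarrow> finite W"
  using finite_subset finite_verts unfolding resolving_set_def by blast

text \<open>The definition only forbids resolving subsets with exactly one element fewer. By
  monotonicity, any resolving proper subset that misses \<open>w\<close> can be enlarged to
  \<open>W - {w}\<close>, so both readings of minimality agree.\<close>

lemma minimal_resolving_set_iff:
  "minimal_resolving_set W \<longleftrightarrow> resolving_set W \<and> (\<forall>W'. W' \<subset> W \<longrightarrow> \<not> resolving_set W')"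
proof (cases "resolving_set W")
  case True
  note finite = finite_resolving_set[OF True]
  have "\<exists>V\<subset>W. resolving_set V \<and> card V = card W - 1" if W': "W' \<subset> W" "resolving_set W'" for W'
  proof -
    obtain w where w: "w \<in> W" "w \<notin> W'"
      using W' by blast
    have "resolving_set (W - {w})"
      using W'(2) by (rule resolving_set_mono) (use W' w True in \<open>auto simp: resolving_set_def\<close>)
    then show ?thesis
      using w finite by (intro exI[of _ "W - {w}"]) auto
  qed
  then show ?thesis
    using True by (auto simp: minimal_resolving_set_def)
qed (simp add: minimal_resolving_set_def)

lemma minimal_resolving_set_subset_exists:
  assumes "resolving_set R"
  shows "\<exists>W\<subseteq>R. minimal_resolving_set W"
proof -
  let ?S = "{W. W \<subseteq> R \<and> resolving_set W}"
  have "finite ?S"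
    by (rule finite_subset[of _ "Pow R"]) (use finite_resolving_set[OF assms] in blast)+
  moreover have "?S \<noteq> {}"
    using assms by blast
  ultimately have "\<exists>W\<in>?S. \<forall>V\<in>?S. V \<subseteq> W \<longrightarrow> W = V"
    by (rule finite_has_minimal)
  then obtain W where W: "W \<subseteq> R" "resolving_set W"
      and min: "\<And>V. V \<in> ?S \<Longrightarrow> V \<subseteq> W \<Longrightarrow> W = V"
    by auto
  have "\<not> resolving_set V" if "V \<subset> W" for V
    using min[of V] W(1) that by auto
  then show ?thesis
    using W by (auto simp: minimal_resolving_set_iff)
qed

text \<open>A minimal resolving set inside \<open>R\<close> that avoided \<open>r\<close> would lie
  in \<open>R - {r}\<close> and make that set resolving by monotonicity. This gives control over one
  element of a minimal set without constructing the set.\<close>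

lemma minimal_resolving_set_containing_exists:
  assumes "resolving_set R" "\<not> resolving_set (R - {r})"
  shows "\<exists>W. minimal_resolving_set W \<and> r \<in> W"
proof -
  obtain W where W: "W \<subseteq> R" "minimal_resolving_set W"
    using minimal_resolving_set_subset_exists[OF assms(1)] by blast
  have "r \<in> W"
  proof (rule ccontr)
    assume "r \<notin> W"
    then have "resolving_set (R - {r})"
      using W assms(1) resolving_set_mono[of W "R - {r}"]
      by (auto simp: minimal_resolving_set_def resolving_set_def)
    then show False
      using assms(2) by blast
  qed
  then show ?thesis
    using W by blast
qed

lemma minimal_resolving_set_minimum:
  assumes "resolving_set W" "\<And>V. resolving_set V \<Longrightarrow> card W \<le> card V"
  shows "minimal_resolving_set W"
proof -
  have "\<not> resolving_set V" if "V \<subset> W" for V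
    using psubset_card_mono[OF finite_resolving_set[OF assms(1)] that] assms(2)[of V] by auto
  then show ?thesis
    using assms(1) by (simp add: minimal_resolving_set_iff)
qed

lemma metric_dimension_eqI:
  assumes "resolving_set W" "\<And>V. resolving_set V \<Longrightarrow> card W \<le> card V"
  shows "metric_dimension = card W"
  unfolding metric_dimension_def using assms by (auto intro!: Least_equality)

end

section \<open>The intersection graph of all nonempty subsets\<close>

locale nonempty_subsets_graph =
  fixes Y :: "'a set"
  assumes finite_Y: "finite Y"
begin

abbreviation M :: "'a set set" where
  "M \<equiv> Pow Y - {{}}"

sublocale graph "with_proj (intersection_graph M)"
  by (rule graph_intersection_graph) (simp add: finite_Y)

section \<open>Distances and resolvability in terms of intersections\<close>

lemma card_M: "card M = 2 ^ card Y - 1"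
  using finite_Y by (simp add: card_Diff_subset card_Pow)

lemma verts_eq: "verts (with_proj (intersection_graph M)) = M"
  by (simp add: intersection_graph_def)

lemma adjacent_iff:
  "A \<rightarrow>\<^bsub>with_proj (intersection_graph M)\<^esub> B \<longleftrightarrow> A \<in> M \<and> B \<in> M \<and> A \<noteq> B \<and> A \<inter> B \<noteq> {}"
  by (simp add: intersection_graph_def)

lemma graph_dist_eq:
  assumes "A \<in> M" "B \<in> M"
  shows "graph_dist A B = (if A = B then 0 else if A \<inter> B \<noteq> {} then 1 else 2)"
proof -
  consider "A = B" | "A \<noteq> B" "A \<inter> B \<noteq> {}" | "A \<noteq> B" "A \<inter> B = {}"
    by blast
  then show ?thesis
  proof cases
    case 1
    then show ?thesis
      using assms graph_dist_self[of B] unfolding verts_eq by simp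
  next
    case 2
    then have "graph_dist A B = 1"
      using assms by (intro graph_dist_adjacent) (simp only: adjacent_iff simp_thms)
    with 2 show ?thesis
      by simp
  next
    case 3
    \<comment> \<open>The union of two disjoint nonempty sets differs from both and meets both, so
      it is a common neighbour.\<close>
    have "A \<union> B \<in> M" "A \<noteq> A \<union> B" "A \<union> B \<noteq> B" "A \<inter> (A \<union> B) \<noteq> {}" "(A \<union> B) \<inter> B \<noteq> {}"
      using 3 assms by auto
    then have "graph_dist A B = 2"
      using 3 assms
      by (intro graph_dist_common_neighbour[where w = "A \<union> B"]) (simp_all only: adjacent_iff simp_thms)
    with 3 show ?thesis
      by simp
  qed
qed

text \<open>A member of \<open>W\<close> is identified by its own coordinate, which is 0 for no
  other vertex. For vertices outside \<open>W\<close> all coordinates are 1 or 2, and the choice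
  records only whether the two sets meet.\<close>

lemma resolving_set_iff:
  "resolving_set W \<longleftrightarrow> W \<subseteq> M \<and> W \<noteq> {} \<and>
    (\<forall>A\<in>M - W. \<forall>B\<in>M - W. (\<forall>w\<in>W. A \<inter> w = {} \<longleftrightarrow> B \<inter> w = {}) \<longrightarrow> A = B)"
proof (cases "W \<subseteq> M")
  case True
  have member: "graph_dist A B = graph_dist B B \<longleftrightarrow> A = B" if "A \<in> M" "B \<in> M" for A B
    unfolding graph_dist_eq[OF that] graph_dist_eq[OF that(2,2)] by simp
  have nonmember: "graph_dist A w = graph_dist B w \<longleftrightarrow> (A \<inter> w = {} \<longleftrightarrow> B \<inter> w = {})"
    if "A \<in> M - W" "B \<in> M - W" "w \<in> W" for A B w
  proof -
    have "A \<in> M" "B \<in> M" "w \<in> M" "A \<noteq> w" "B \<noteq> w"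
      using that True by auto
    then show ?thesis
      by (simp add: graph_dist_eq del: Diff_iff)
  qed
  have "(\<forall>A\<in>M. \<forall>B\<in>M. (\<forall>w\<in>W. graph_dist A w = graph_dist B w) \<longrightarrow> A = B) \<longleftrightarrow>
      (\<forall>A\<in>M - W. \<forall>B\<in>M - W. (\<forall>w\<in>W. A \<inter> w = {} \<longleftrightarrow> B \<inter> w = {}) \<longrightarrow> A = B)"
    (is "?dist \<longleftrightarrow> ?meets")
  proof
    assume dist: ?dist
    show ?meets
    proof (intro ballI impI)
      fix A B
      assume AB: "A \<in> M - W" "B \<in> M - W" and eq: "\<forall>w\<in>W. A \<inter> w = {} \<longleftrightarrow> B \<inter> w = {}"
      have "\<forall>w\<in>W. graph_dist A w = graph_dist B w"
        using nonmember[OF AB] eq by simp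
      then show "A = B"
        using dist DiffD1[OF AB(1)] DiffD1[OF AB(2)] by simp
    qed
  next
    assume meets: ?meets
    show ?dist
    proof (intro ballI impI)
      fix A B
      assume AB: "A \<in> M" "B \<in> M" and eq: "\<forall>w\<in>W. graph_dist A w = graph_dist B w"
      consider "A \<in> W" | "B \<in> W" | "A \<in> M - W" "B \<in> M - W"
        using AB by auto
      then show "A = B"
      proof cases
        case 1
        then show ?thesis using member[OF AB(2,1)] eq by simp
      next
        case 2
        then show ?thesis using member[OF AB] eq by simp
      next
        case 3
        then have "\<forall>w\<in>W. A \<inter> w = {} \<longleftrightarrow> B \<inter> w = {}"
          using nonmember[OF 3] eq by simp
        then show ?thesis
          using meets 3 by simp
      qed
    qed
  qed
  then show ?thesis
    unfolding resolving_set_iff_dist verts_eq by (simp only:)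
next
  case False
  then show ?thesis
    by (simp only: resolving_set_def verts_eq simp_thms)
qed

lemma not_resolving_setI:
  assumes "A \<in> M - W" "B \<in> M - W" "A \<noteq> B" "\<And>w. w \<in> W \<Longrightarrow> A \<inter> w = {} \<longleftrightarrow> B \<inter> w = {}"
  shows "\<not> resolving_set W"
proof
  assume "resolving_set W"
  then have "\<forall>A\<in>M - W. \<forall>B\<in>M - W. (\<forall>w\<in>W. A \<inter> w = {} \<longleftrightarrow> B \<inter> w = {}) \<longrightarrow> A = B"
    unfolding resolving_set_iff by (elim conjE)
  from this[rule_format, OF assms(1,2,4)] show False
    using assms(3) by simp
qed

section \<open>Metric dimension\<close>

lemma resolving_set_singletons:
  assumes "Y \<noteq> {}"
  shows "resolving_set ((\<lambda>y. {y}) ` Y)"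
  unfolding resolving_set_iff using assms by auto

lemma card_singletons: "card ((\<lambda>y. {y}) ` Y) = card Y"
  by (simp add: card_image)

text \<open>Sending a vertex outside \<open>W\<close> to the set of members of \<open>W\<close> that
  it meets is injective into \<open>Pow W\<close>; the members of \<open>W\<close> themselves are
  counted separately.\<close>

lemma card_resolving_set_bound:
  assumes "resolving_set W"
  shows "2 ^ card Y - 1 \<le> card W + 2 ^ card W"
proof -
  have W: "W \<subseteq> M" "finite W"
    using assms finite_resolving_set by (auto simp: resolving_set_iff)
  have "inj_on (\<lambda>A. {w \<in> W. A \<inter> w \<noteq> {}}) (M - W)"
  proof (rule inj_onI)
    fix A B
    assume AB: "A \<in> M - W" "B \<in> M - W"
      and eq: "{w \<in> W. A \<inter> w \<noteq> {}} = {w \<in> W. B \<inter> w \<noteq> {}}"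
    have "A \<inter> w = {} \<longleftrightarrow> B \<inter> w = {}" if "w \<in> W" for w
    proof -
      have "w \<in> {w \<in> W. A \<inter> w \<noteq> {}} \<longleftrightarrow> w \<in> {w \<in> W. B \<inter> w \<noteq> {}}"
        by (simp only: eq)
      then show ?thesis
        using that by simp
    qed
    then show "A = B"
      using not_resolving_setI[OF AB] assms by metis
  qed
  moreover have "(\<lambda>A. {w \<in> W. A \<inter> w \<noteq> {}}) ` (M - W) \<subseteq> Pow W"
    by blast
  ultimately have "card (M - W) \<le> card (Pow W)"
    using W(2) by (meson card_inj_on_le finite_Pow_iff)
  moreover have "card M \<le> card W + card (M - W)"
    using diff_card_le_card_Diff[OF W(2), of M] by linarith
  ultimately show ?thesis
    using W(2) by (simp add: card_M card_Pow)
qed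

lemma card_resolving_set_ge:
  assumes "resolving_set W" "card Y \<noteq> 2"
  shows "card Y \<le> card W"
proof (rule ccontr)
  assume "\<not> card Y \<le> card W"
  \<comment> \<open>Nonemptiness of \<open>W\<close> rules out \<open>card Y \<le> 1\<close>, so
    with 2 excluded only \<open>card Y \<ge> 3\<close> remains.\<close>
  moreover have "card W \<ge> 1"
    using assms(1) finite_resolving_set by (auto simp: resolving_set_def Suc_le_eq card_gt_0_iff)
  ultimately have "card Y \<ge> 3" "card W < card Y"
    using assms(2) by linarith+
  then obtain k where k: "card Y = k + 3" "card W \<le> k + 2"
    using nat_le_iff_add[of 3 "card Y"] by auto
  \<comment> \<open>The counting bound turns into 4 * 2^k <= k + 3, which contradicts k <
    2^k.\<close>
  have "(2::nat) ^ (k + 3) - 1 \<le> (k + 2) + 2 ^ (k + 2)"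
    using card_resolving_set_bound[OF assms(1)] k power_increasing[OF k(2), of "2::nat"] by simp
  moreover have "(2::nat) ^ (k + 3) = 8 * 2 ^ k" "(2::nat) ^ (k + 2) = 4 * 2 ^ k"
    by (simp_all add: power_add)
  moreover have "k < 2 ^ k"
    by (rule less_exp)
  ultimately show False
    by linarith
qed

lemma metric_dimension_eq:
  assumes "Y \<noteq> {}" "card Y \<noteq> 2"
  shows "metric_dimension = card Y"
  using metric_dimension_eqI[OF resolving_set_singletons] assms card_resolving_set_ge
  by (simp add: card_singletons)

section \<open>Failure of exchange for three or more points\<close>

lemma minimal_resolving_set_containing_Y_exists:
  assumes "card Y \<ge> 3"
  shows "\<exists>W. minimal_resolving_set W \<and> Y \<in> W"
proof -
  obtain a b c where abc: "a \<in> Y" "b \<in> Y" "c \<in> Y" "a \<noteq> b" "a \<noteq> c" "b \<noteq> c"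
    using card_ge_3E[OF assms] by metis
  define R where "R = M - {{a}, Y - {a}}"
  \<comment> \<open>The third point \<open>c\<close> keeps \<open>{b}\<close> in \<open>R\<close>,
    where it separates the only two vertices outside \<open>R\<close>.\<close>
  have "{b} \<noteq> Y - {a}"
    using abc by (metis Diff_iff singletonD)
  then have "{b} \<in> R"
    using abc by (simp add: R_def)
  have "resolving_set R"
    unfolding resolving_set_iff
  proof (intro conjI ballI impI)
    fix A B
    assume AB: "A \<in> M - R" "B \<in> M - R" and eq: "\<forall>w\<in>R. A \<inter> w = {} \<longleftrightarrow> B \<inter> w = {}"
    have "b \<in> A \<longleftrightarrow> b \<in> B"
      using bspec[OF eq \<open>{b} \<in> R\<close>] by simp
    moreover have "A = {a} \<or> A = Y - {a}" "B = {a} \<or> B = Y - {a}"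
      using AB unfolding R_def by fast+
    moreover have "b \<notin> {a}" "b \<in> Y - {a}"
      using abc by simp_all
    ultimately show "A = B"
      by metis
  next
    show "R \<subseteq> M"
      unfolding R_def by (rule Diff_subset)
    show "R \<noteq> {}"
      using \<open>{b} \<in> R\<close> by (rule ex_in_conv[THEN iffD1, OF exI])
  qed
  moreover have "\<not> resolving_set (R - {Y})"
  proof (rule not_resolving_setI)
    show "Y \<noteq> Y - {a}"
      using abc(1) by blast
    have "b \<in> Y - {a}"
      using abc by simp
    then have "Y - {a} \<noteq> {}"
      by (rule ex_in_conv[THEN iffD1, OF exI])
    then show "Y - {a} \<in> M - (R - {Y})"
      by (simp add: R_def Diff_subset del: Diff_eq_empty_iff)
    show "Y \<in> M - (R - {Y})"
      using abc(1) by auto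
    show "Y \<inter> w = {} \<longleftrightarrow> (Y - {a}) \<inter> w = {}" if "w \<in> R - {Y}" for w
    proof -
      \<comment> \<open>A nonempty \<open>w\<close> that misses \<open>Y - {a}\<close> could only be
        \<open>{a}\<close>, which \<open>R\<close> omits. Hence both sets meet every remaining
        \<open>w\<close>.\<close>
      have "w \<subseteq> Y" "w \<noteq> {}" "w \<noteq> {a}"
        using that by (simp_all add: R_def)
      then have "Y \<inter> w \<noteq> {}" "(Y - {a}) \<inter> w \<noteq> {}"
        by auto
      then show ?thesis
        by simp
    qed
  qed
  ultimately show ?thesis
    by (rule minimal_resolving_set_containing_exists)
qed

text \<open>A resolving set of the smallest possible size is minimal, so it can serve as the second
  set of the exchange while \<open>Y\<close> comes from a minimal set known only to exist.\<close>

lemma not_exchange_property: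
  assumes "card Y \<ge> 3" "resolving_set W" "card W = card Y"
    and "\<And>s. s \<in> W \<Longrightarrow> \<not> resolving_set (insert Y (W - {s}))"
  shows "\<not> exchange_property"
proof -
  obtain V where "minimal_resolving_set V" "Y \<in> V"
    using minimal_resolving_set_containing_Y_exists[OF assms(1)] by blast
  moreover have "minimal_resolving_set W"
    using assms(1-3) card_resolving_set_ge by (intro minimal_resolving_set_minimum) auto
  moreover have "\<not> minimal_resolving_set (W - {s} \<union> {Y})" if "s \<in> W" for s
    using assms(4)[OF that] by (simp add: minimal_resolving_set_def)
  ultimately show ?thesis
    unfolding exchange_property_def by metis
qed

lemma not_exchange_property_ge_4:
  assumes "card Y \<ge> 4"
  shows "\<not> exchange_property"
proof (rule not_exchange_property)
  show "resolving_set ((\<lambda>y. {y}) ` Y)"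
    using assms by (intro resolving_set_singletons) auto
  show "\<not> resolving_set (insert Y ((\<lambda>y. {y}) ` Y - {s}))" if s: "s \<in> (\<lambda>y. {y}) ` Y" for s
  proof -
    obtain i where i: "i \<in> Y" "s = {i}"
      using s by blast
    then have "3 \<le> card (Y - {i})"
      using assms finite_Y by simp
    then obtain j k l where jkl: "j \<in> Y - {i}" "k \<in> Y - {i}" "l \<in> Y - {i}"
        "j \<noteq> k" "j \<noteq> l" "k \<noteq> l"
      by (rule card_ge_3E)
    \<comment> \<open>Without \<open>{i}\<close> nothing detects \<open>i\<close>, so
      \<open>{j, k}\<close> and \<open>{i, j, k}\<close> look alike. The fourth point
      \<open>l\<close> keeps both different from \<open>Y\<close>, and their sizes keep both out of
      the singletons.\<close>
    have "l \<notin> {j, k}" "l \<notin> {i, j, k}" "l \<in> Y"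
      using jkl by auto
    then have neq_Y: "{j, k} \<noteq> Y" "{i, j, k} \<noteq> Y"
      by metis+
    have neq_singleton: "{j, k} \<noteq> {y}" "{i, j, k} \<noteq> {y}" for y
      using jkl(4) by (metis insertI1 insertI2 singletonD)+
    show ?thesis
    proof (rule not_resolving_setI)
      show "{j, k} \<in> M - insert Y ((\<lambda>y. {y}) ` Y - {s})"
          "{i, j, k} \<in> M - insert Y ((\<lambda>y. {y}) ` Y - {s})"
        using i(1) jkl neq_Y neq_singleton by (simp_all add: image_iff)
      have "i \<notin> {j, k}" "i \<in> {i, j, k}"
        using jkl by auto
      then show "{j, k} \<noteq> {i, j, k}"
        by metis
      fix w
      assume "w \<in> insert Y ((\<lambda>y. {y}) ` Y - {s})"
      then consider "w = Y" | y where "w = {y}" "y \<noteq> i"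
        using i by auto
      then show "{j, k} \<inter> w = {} \<longleftrightarrow> {i, j, k} \<inter> w = {}"
        using jkl by cases auto
    qed
  qed
qed (use assms card_singletons in auto)

text \<open>The singletons do not work here: after replacing \<open>{i}\<close> by \<open>Y\<close>,
  the vertices left outside are \<open>{i}\<close>, \<open>{i, j}\<close>, \<open>{i, k}\<close>,
  \<open>{j, k}\<close>, and \<open>{j}\<close> and \<open>{k}\<close> still tell them
  apart.\<close>

lemma not_exchange_property_3:
  assumes "card Y = 3"
  shows "\<not> exchange_property"
proof -
  obtain a b c where Y: "Y = {a, b, c}" and abc: "a \<noteq> b" "a \<noteq> c" "b \<noteq> c"
    using assms by (auto simp: card_3_iff)
  have M: "M = {{a}, {b}, {c}, {a, b}, {a, c}, {b, c}, {a, b, c}}"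
    unfolding Y by (auto simp: Pow_insert)
  show ?thesis
  proof (rule not_exchange_property)
    show "resolving_set {{a}, {a, b}, {a, c}}"
      unfolding resolving_set_iff
    proof (intro conjI ballI impI)
      fix A B
      assume AB: "A \<in> M - {{a}, {a, b}, {a, c}}" "B \<in> M - {{a}, {a, b}, {a, c}}"
        and "\<forall>w\<in>{{a}, {a, b}, {a, c}}. A \<inter> w = {} \<longleftrightarrow> B \<inter> w = {}"
      then have "a \<in> A \<longleftrightarrow> a \<in> B" "a \<in> A \<or> b \<in> A \<longleftrightarrow> a \<in> B \<or> b \<in> B"
          "a \<in> A \<or> c \<in> A \<longleftrightarrow> a \<in> B \<or> c \<in> B"
        by auto
      moreover have "A = {b} \<or> A = {c} \<or> A = {b, c} \<or> A = {a, b, c}"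
          "B = {b} \<or> B = {c} \<or> B = {b, c} \<or> B = {a, b, c}"
        using AB unfolding M by fast+
      ultimately show "A = B"
        using abc by (elim disjE) simp_all
    qed (simp_all add: M)
    show "\<not> resolving_set (insert Y ({{a}, {a, b}, {a, c}} - {s}))" if s: "s \<in> {{a}, {a, b}, {a, c}}" for s
    proof -
      \<comment> \<open>Each removal leaves a confused pair: without \<open>{a}\<close>, both
        \<open>{a}\<close> and \<open>{b, c}\<close> meet everything that remains; without
        \<open>{a, b}\<close> or \<open>{a, c}\<close>, adding \<open>b\<close> to
        \<open>{c}\<close> or \<open>c\<close> to \<open>{b}\<close> goes unnoticed.\<close>
      consider "s = {a}" | "s = {a, b}" | "s = {a, c}"
        using s by blast
      then show ?thesis
      proof cases
        case 1
        then show ?thesis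
          by (intro not_resolving_setI[of "{a}" _ "{b, c}"]) (use abc Y in \<open>auto\<close>)
      next
        case 2
        then show ?thesis
          by (intro not_resolving_setI[of "{c}" _ "{b, c}"]) (use abc Y in \<open>auto\<close>)
      next
        case 3
        then show ?thesis
          by (intro not_resolving_setI[of "{b}" _ "{b, c}"]) (use abc Y in \<open>auto\<close>)
      qed
    qed
    show "card {{a}, {a, b}, {a, c}} = card Y"
      using assms abc by (auto simp: card_insert_if doubleton_eq_iff)
  qed (use assms in simp)
qed

section \<open>Exchange for two points\<close>

text \<open>Every minimal resolving set turns out to have one element, so exchanging that element
  for \<open>r\<close> simply turns \<open>W2\<close> into \<open>W1\<close>.\<close>

lemma exchange_property_2:
  assumes "card Y = 2"
  shows "exchange_property"
proof -
  obtain a b where Y: "Y = {a, b}" and "a \<noteq> b"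
    using assms by (auto simp: card_2_iff)
  have M: "M = {{a}, {b}, {a, b}}"
    unfolding Y by (auto simp: Pow_insert)
  have *: "resolving_set {{x}}" if M: "M = {{x}, {y}, {x, y}}" and "x \<noteq> y" for x y
    unfolding resolving_set_iff
  proof (intro conjI ballI impI)
    fix A B
    assume AB: "A \<in> M - {{x}}" "B \<in> M - {{x}}" and "\<forall>w\<in>{{x}}. A \<inter> w = {} \<longleftrightarrow> B \<inter> w = {}"
    then have "x \<in> A \<longleftrightarrow> x \<in> B"
      by simp
    moreover have "A = {y} \<or> A = {x, y}" "B = {y} \<or> B = {x, y}"
      using AB unfolding M by fast+
    ultimately show "A = B"
      using \<open>x \<noteq> y\<close> by (metis insertI1 singletonD)
  qed (simp_all add: M)
  have singleton: "resolving_set {{a}}" "resolving_set {{b}}"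
    using *[of a b] *[of b a] M \<open>a \<noteq> b\<close> by (simp_all add: insert_commute)
  have min_singleton: "\<exists>x. W = {x}" if W: "minimal_resolving_set W" for W
  proof -
    have res: "resolving_set W" and min: "\<And>V. V \<subset> W \<Longrightarrow> \<not> resolving_set V"
      using W unfolding minimal_resolving_set_iff by simp_all
    \<comment> \<open>Otherwise \<open>Y\<close> is the only possible member of \<open>W\<close>,
      and it meets both \<open>{a}\<close> and \<open>{b}\<close>.\<close>
    have "{a} \<in> W \<or> {b} \<in> W"
    proof (rule ccontr)
      assume not: "\<not> ({a} \<in> W \<or> {b} \<in> W)"
      have "W \<subseteq> M"
        using res unfolding resolving_set_iff by (elim conjE)
      with not have "w = Y" if "w \<in> W" for w
        using that unfolding M unfolding Y by fast
      moreover have "{a} \<in> M - W" "{b} \<in> M - W"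
        using not unfolding M by simp_all
      ultimately have "\<not> resolving_set W"
        using \<open>a \<noteq> b\<close> Y by (intro not_resolving_setI[of "{a}" _ "{b}"]) simp_all
      then show False
        using res by simp
    qed
    then obtain x where x: "{x} \<in> W" "resolving_set {{x}}"
      using singleton by metis
    have "W = {{x}}"
      using min[of "{{x}}"] x by auto
    then show ?thesis
      by simp
  qed
  show ?thesis
    unfolding exchange_property_def
  proof (intro allI impI)
    fix W1 W2 r
    assume *: "minimal_resolving_set W1 \<and> minimal_resolving_set W2 \<and> r \<in> W1"
    then obtain x where "W1 = {r}" "W2 = {x}"
      using min_singleton by (metis singletonD)
    then show "\<exists>s\<in>W2. minimal_resolving_set (W2 - {s} \<union> {r})"
      using * by simp
  qed
qed

lemma exchange_property_iff:
  assumes "card Y \<ge> 2"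
  shows "exchange_property \<longleftrightarrow> card Y = 2"
proof -
  consider "card Y = 2" | "card Y = 3" | "card Y \<ge> 4"
    using assms by linarith
  then show ?thesis
    using exchange_property_2 not_exchange_property_3 not_exchange_property_ge_4 by cases auto
qed

end

text \<open>The two guards exclude genuine exceptions. For \<open>n = 2\<close> the single vertex
  \<open>{1}\<close> already resolves, so the dimension is 1. For \<open>n = 1\<close> the only
  resolving set is \<open>{Y}\<close>, so exchange holds trivially although \<open>n\<close> is not
  2.\<close>

theorem corollary4p2:
  fixes n :: nat and Y :: "nat set" and M :: "nat set set"
  assumes "n \<ge> 1"
    and "Y = {1..n}"
    and "M = Pow Y - {{}}"
  shows "(n \<noteq> 2 \<longrightarrow> graph.metric_dimension (with_proj (intersection_graph M)) = n) \<and>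
    (n \<ge> 2 \<longrightarrow> (graph.exchange_property (with_proj (intersection_graph M)) \<longleftrightarrow> n = 2))"
proof -
  interpret nonempty_subsets_graph Y
    by unfold_locales (simp add: assms(2))
  show ?thesis
    using metric_dimension_eq exchange_property_iff assms by simp
qed

end
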